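(* Let $D$ be a data structure, $R$ an SMR (safe memory reclamation) implementation used by $D$ such that $D(R)$ is compositional, and $\mathcal{O}$ an observer automaton (the SMR specification). Suppose $R \models \mathcal{O}$, i.e. $\mathcal{H}(\tau)\in\mathcal{S}(\mathcal{O})$ for every $\tau\in[\![MGC(R)]\!]_{Adr}$. If $[\![D(\mathcal{O})]\!]_{Adr}$ is correct, then $[\![D(R)]\!]_{Adr}$ is correct.
   Context: **Memory.** $Adr$ is a set of addresses, $\mathtt{seg}\notin Adr$ the uninitialized pointer value, $Dom\ni 0$ a set of data values. Pointer expressions: $PExp=PVar\uplus\{a.\mathtt{next}\mid a\in Adr\}$; data expressions: $DExp=DVar\uplus\{a.\mathtt{data}\mid a\in Adr\}$. A memory is a partial function $m$ mapping $PExp$ to $Adr\uplus\{\mathtt{seg}\}$ and $DExp$ to $Dom$; $m(e)=\bot$ means undefined. $m[e\mapsto v]$ is the usual update. **Programs and computations.** $D$ uses the functions offered by $R$. A computation is a sequence of actions $(t,com,up)$: thread $t$ executes command $com$, giving memory update $up$. Commands of $D$: $p:=q$, $p:=q.\mathtt{next}$, $p.\mathtt{next}:=q$, $x:=op(x_1,\dots,x_n)$, $x:=q.\mathtt{data}$, $p.\mathtt{data}:=x$, $\mathtt{assert}\ cond$ (with $cond$ one of $p=q$, $p\neq q$, $x=y$, $x\ne y$, $x<y$), $p:=\mathtt{malloc}$, $\mathtt{enter}\ func(\bar p,\bar x)$ and $\mathtt{exit}$ (entering/leaving a function of $R$), where $p,q,p_i\in PVar$ and $x,y,x_i\in DVar$.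 $D$ itself performs no frees. Commands of $R$ include $\mathtt{free}(p)$ and further, unspecified commands (with their own updates). For each thread, only commands of $R$, and all of them, occur between an $\mathtt{enter}$ and the matching $\mathtt{exit}$. The memory $m_\tau$ is defined by $m_\epsilon(p)=\mathtt{seg}$ for $p\in PVar$, $m_\epsilon(x)=0$ for $x\in DVar$, all else $\bot$, and $m_{\tau.(t,com,up)}=m_\tau[up]$. $fresh(\tau)$: initially $Adr$; an address is removed when it is allocated or freed. $freed(\tau)$: initially $\emptyset$; $a$ is added when freed and removed when allocated. **Semantics** $[\![D(R)]\!]_X$ for $X\subseteq Adr$ (the reusable addresses): $\epsilon$ is in it, and $\tau.act$ is in it if $\tau$ is, $act$ respects the control flow of the threads, and one of the following holds (besides the steps of the unspecified commands of $R$): - $act=(t,p:=\mathtt{malloc},[p\mapsto a,a.\mathtt{next}\mapsto\mathtt{seg},a.\mathtt{data}\mapsto d])$, $d\in Dom$ arbitrary, $a\in fresh(\tau)\cup(freed(\tau)\cap X)$; - $act=(t,\mathtt{free}(p),[a.\mathtt{next}\mapsto\bot,a.\mathtt{data}\mapsto\bot])$, $m_\tau(p)=a\in Adr$; - $act=(t,\mathtt{enter}\ func(\bar p,\bar x),\emptyset)$, all $m_\tau(p_i)\in Adr$; or $act=(t,\mathtt{exit},\emptyset)$; - assignments with the evident update computed from $m_\tau$, where every dereferenced pointer variable $p$ (occurring as $p.\mathtt{next}$ or $p.\mathtt{data}$) must satisfy $m_\tau(p)\in Adr$; - $act=(t,\mathtt{assert}\ cond,\emptyset)$ with $cond$ true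 in $m_\tau$. **Control.** In a computation $\tau$ of $D(R)$ each thread $t$ has control $(pc_D,pc_R)$, the next locations in $D$ and $R$; $pc_R=\bot$ means $t$ executes $D$ code, $pc_R\neq\bot$ means it executes $R$ code, and then $pc_D$ is the return location (the matching $\mathtt{exit}$). Steps change $pc_D$ only if $pc_R=\bot$. $ctrl^D(\tau)$ and $ctrl^R(\tau)$ denote the maps from threads to these components. The commands available to a thread and its control after executing one depend only on its control and the command. **Histories.** Events are $func(t,\bar a,\bar d)$, $exit(t)$, $free(a)$. The induced history $\mathcal{H}(\tau)$ is the projection of $\tau$: $\mathtt{enter}\ func(\bar p,\bar x)$ by $t$ contributes $func(t,m(\bar p),m(\bar x))$ (values in the memory just before the action), $\mathtt{exit}$ by $t$ contributes $exit(t)$, $\mathtt{free}(p)$ contributes $free(m(p))$, $\mathtt{free}(a)$ contributes $free(a)$, all else contributes nothing. **Observers.** An observer $\mathcal{O}$ has locations (one initial, some accepting), observer variables, and transitions $l\xrightarrow{f(\bar r),g}l'$, where $f$ is an event type, $\bar r$ formal parameters, and $g$ a Boolean formula over equalities among observer variables and $\bar r$. A state is $(l,\varphi)$ with $\varphi$ a valuation of the observer variables; it is initial/accepting if $l$ is ($\varphi$ is arbitrary initially and never changes). $(l,\varphi)\xrightarrow{f(\bar v)}(l',\varphi)$ is a step if $g$ holds with $\bar r:=\bar v$ and observer variables evaluated by $\varphi$. $\mathcal{S}(s)$ is the set of histories $h$ such that no $s'$ with $s\xrightarrow{h}s'$ is accepting; $\mathcal{S}(\mathcal{O})=\bigcap\{\mathcal{S}(s)\mid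 s\text{ initial}\}$. **$MGC(R)$** is the most general client of $R$: its threads concurrently execute arbitrary sequences of functions of $R$, so that it generates every possible usage of $R$; in particular every history induced by a computation of $D(R)$ is induced by one of $MGC(R)$. **$D(\mathcal{O})$.** The SMR code is removed from $D(R)$ (nothing of $R$ is executed between $\mathtt{enter}$ and $\mathtt{exit}$), giving $D(\epsilon)$, and frees are performed by the environment: $[\![D(\mathcal{O})]\!]_X$ is defined inductively by the rules above for the commands of $D$ plus: if $\tau$ is in the semantics and $\mathcal{H}(\tau).free(a)\in\mathcal{S}(\mathcal{O})$, then $\tau.(t,\mathtt{free}(a),[a.\mathtt{next}\mapsto\bot,a.\mathtt{data}\mapsto\bot])$ is in the semantics. Environment frees do not change control. Here $ctrl(\sigma)$ maps each thread to its $D$-location. **Compositionality.** Variables split as $PVar=PVar^D\uplus PVar^R$, $DVar=DVar^D\uplus DVar^R$. The separated memories $m^D_\tau,m^R_\tau$ start with the initial values of the variables of $D$, resp. $R$, all else $\bot$. For $act=(t,com,up)$: if $com$ is $\mathtt{free}(p)$, both are updated by $up$; otherwise, if $pc_R$ of $t$ after $\tau$ is $\bot$ only $m^D$ is updated by $up$, and if it is $\neq\bot$ only $m^R$ is updated by $up$. A computation $\tau$ of $D(R)$ is compositional if for every prefix $\sigma.act$: (i) $m_{\sigma.act}=m^D_{\sigma.act}\uplus m^R_{\sigma.act}$; (ii) $m_{\sigma.act}(e)=m^D_{\sigma.act}(e)$ for all $e\in PVar^D\cup DVar^D$; (iii) if $act$ is an action of $D$ whose command is an assignment $expr:=p.sel$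 with $sel\in\{\mathtt{next},\mathtt{data}\}$ and $m_\sigma(p)=a$, then $m_\sigma(a.sel)=m^D_\sigma(a.sel)$. $D(R)$ is compositional if all $\tau\in[\![D(R)]\!]_{Adr}$ are. **Correctness.** Let $Bad$ be a fixed set of control states of $D$. $D(R)$ (i.e. $[\![D(R)]\!]_{Adr}$) is correct if there is no $\tau\in[\![D(R)]\!]_{Adr}$ with $ctrl^D(\tau)\in Bad$; $D(\mathcal{O})$ is correct if there is no $\sigma\in[\![D(\mathcal{O})]\!]_{Adr}$ with $ctrl(\sigma)\in Bad$. *)

theory Defs
  imports Main
begin

section \<open>Memory\<close>

text \<open>
  Throughout, \<^typ>\<open>'p\<close> and \<^typ>\<open>'x\<close> are the pointer and data variables, \<^typ>\<open>'a\<close> the addresses,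
  \<^typ>\<open>'d\<close> the data values, \<^typ>\<open>'t\<close> the threads, \<^typ>\<open>'f\<close> the functions offered by the SMR
  implementation and \<^typ>\<open>'c\<close> its unspecified commands. The set of all addresses is the
  universe of \<^typ>\<open>'a\<close>.
\<close>

datatype ('p, 'a) pexp = PVar 'p | Next 'a
datatype ('x, 'a) dexp = DVar 'x | Data 'a

datatype 'a ptr = Seg | Adr 'a

record ('p, 'x, 'a, 'd) memory =
  pmem :: "('p, 'a) pexp \<rightharpoonup> 'a ptr"
  dmem :: "('x, 'a) dexp \<rightharpoonup> 'd"

text \<open>
  In an update, \<^const>\<open>None\<close> means that the expression is not updated, and \<^term>\<open>Some None\<close> that
  it becomes undefined.
\<close>

record ('p, 'x, 'a, 'd) update =
  pupd :: "('p, 'a) pexp \<rightharpoonup> 'a ptr option"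
  dupd :: "('x, 'a) dexp \<rightharpoonup> 'd option"

definition override :: "('e \<rightharpoonup> 'v) \<Rightarrow> ('e \<rightharpoonup> 'v option) \<Rightarrow> ('e \<rightharpoonup> 'v)" where
  "override m u = (\<lambda>e. case u e of None \<Rightarrow> m e | Some v \<Rightarrow> v)"

definition apply_update ::
    "('p, 'x, 'a, 'd) memory \<Rightarrow> ('p, 'x, 'a, 'd) update \<Rightarrow> ('p, 'x, 'a, 'd) memory" where
  "apply_update m up =
     \<lparr> pmem = override (pmem m) (pupd up), dmem = override (dmem m) (dupd up) \<rparr>"

definition no_update :: "('p, 'x, 'a, 'd) update" where
  "no_update = \<lparr> pupd = Map.empty, dupd = Map.empty \<rparr>"

definition pset :: "('p, 'a) pexp \<Rightarrow> 'a ptr option \<Rightarrow> ('p, 'x, 'a, 'd) update" where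
  "pset e v = \<lparr> pupd = [e \<mapsto> v], dupd = Map.empty \<rparr>"

definition dset :: "('x, 'a) dexp \<Rightarrow> 'd option \<Rightarrow> ('p, 'x, 'a, 'd) update" where
  "dset e v = \<lparr> pupd = Map.empty, dupd = [e \<mapsto> v] \<rparr>"

definition malloc_update :: "'p \<Rightarrow> 'a \<Rightarrow> 'd \<Rightarrow> ('p, 'x, 'a, 'd) update" where
  "malloc_update p a d =
     \<lparr> pupd = [PVar p \<mapsto> Some (Adr a), Next a \<mapsto> Some Seg], dupd = [Data a \<mapsto> Some d] \<rparr>"

definition free_update :: "'a \<Rightarrow> ('p, 'x, 'a, 'd) update" where
  "free_update a = \<lparr> pupd = [Next a \<mapsto> None], dupd = [Data a \<mapsto> None] \<rparr>"

definition init_mem :: "'p set \<Rightarrow> 'x set \<Rightarrow> ('p, 'x, 'a, 'd::zero) memory" where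
  "init_mem P V =
     \<lparr> pmem = (\<lambda>e. case e of PVar p \<Rightarrow> if p \<in> P then Some Seg else None | Next a \<Rightarrow> None),
       dmem = (\<lambda>e. case e of DVar x \<Rightarrow> if x \<in> V then Some 0 else None | Data a \<Rightarrow> None) \<rparr>"


section \<open>Commands and computations\<close>

datatype (pvars_cond: 'p, dvars_cond: 'x) cond =
  PEq 'p 'p | PNeq 'p 'p | DEq 'x 'x | DNeq 'x 'x | DLess 'x 'x

text \<open>
  One type for the commands of the data structure, of the SMR implementation and of the
  environment; which party may use which command is fixed by \<open>data_structure\<close> and
  \<open>smr_implementation\<close> below. \<open>FreeAdr a\<close> is the environment's \<open>free(a)\<close> and \<open>RCom c\<close> an
  unspecified command of the SMR implementation.
\<close>

datatype (pvars_com: 'p, dvars_com: 'x, 'a, dead 'd, 'f, 'c) com =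
    PAssign 'p 'p                        \<comment> \<open>\<open>p := q\<close>\<close>
  | PLoad 'p 'p                          \<comment> \<open>\<open>p := q.next\<close>\<close>
  | PStore 'p 'p                         \<comment> \<open>\<open>p.next := q\<close>\<close>
  | DAssign 'x "'d list \<Rightarrow> 'd" "'x list" \<comment> \<open>\<open>x := op(x1,...,xn)\<close>\<close>
  | DLoad 'x 'p                          \<comment> \<open>\<open>x := q.data\<close>\<close>
  | DStore 'p 'x                         \<comment> \<open>\<open>p.data := x\<close>\<close>
  | Assert "('p, 'x) cond"
  | Malloc 'p
  | is_Enter: Enter 'f "'p list" "'x list"
  | Exit
  | is_FreeVar: FreeVar 'p
  | is_FreeAdr: FreeAdr 'a
  | is_RCom: RCom 'c

type_synonym ('p, 'x, 'a, 'd, 'f, 'c, 't) action =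
  "'t \<times> ('p, 'x, 'a, 'd, 'f, 'c) com \<times> ('p, 'x, 'a, 'd) update"

text \<open>
  Computations are lists of actions in reverse order: the head is the most recent action, so
  \<open>act # \<tau>\<close> is the computation \<open>\<tau>.act\<close>, and the prefixes of a computation are the suffixes
  of the list. (Histories, below, are in chronological order.)
\<close>

type_synonym ('p, 'x, 'a, 'd, 'f, 'c, 't) computation =
  "('p, 'x, 'a, 'd, 'f, 'c, 't) action list"

primrec mem :: "('p, 'x, 'a, 'd::zero, 'f, 'c, 't) computation \<Rightarrow> ('p, 'x, 'a, 'd) memory" where
  "mem [] = init_mem UNIV UNIV"
| "mem (act # \<tau>) = apply_update (mem \<tau>) (snd (snd act))"

text \<open>The addresses allocated and freed by an action; \<open>m\<close> is the memory before the action.\<close>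

definition allocated :: "('p, 'x, 'a, 'd, 'f, 'c, 't) action \<Rightarrow> 'a set" where
  "allocated act =
     (case act of (t, com, up) \<Rightarrow>
        {a. \<exists>p. com = Malloc p \<and> pupd up (PVar p) = Some (Some (Adr a))})"

definition deallocated ::
    "('p, 'x, 'a, 'd) memory \<Rightarrow> ('p, 'x, 'a, 'd, 'f, 'c, 't) action \<Rightarrow> 'a set" where
  "deallocated m act =
     (case act of (t, com, up) \<Rightarrow>
        {a. com = FreeAdr a \<or> (\<exists>p. com = FreeVar p \<and> pmem m (PVar p) = Some (Adr a))})"

primrec fresh :: "('p, 'x, 'a, 'd::zero, 'f, 'c, 't) computation \<Rightarrow> 'a set" where
  "fresh [] = UNIV"
| "fresh (act # \<tau>) = fresh \<tau> - allocated act - deallocated (mem \<tau>) act"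

primrec freed :: "('p, 'x, 'a, 'd::zero, 'f, 'c, 't) computation \<Rightarrow> 'a set" where
  "freed [] = {}"
| "freed (act # \<tau>) = (freed \<tau> - allocated act) \<union> deallocated (mem \<tau>) act"


section \<open>Histories\<close>

text \<open>
  The data arguments of a function call are the values of variables, which may be undefined
  (after reading the data field of a freed address).
\<close>

datatype ('f, 't, 'a, 'd) event =
  Func 'f 't "'a list" "'d option list" | ExitEv 't | FreeEv 'a

definition adr_of :: "'a ptr option \<Rightarrow> 'a" where
  "adr_of v = (THE a. v = Some (Adr a))"

text \<open>
  The use of \<^const>\<open>adr_of\<close> is harmless: \<open>Enter\<close> and \<open>FreeVar\<close> are enabled only if all their
  pointer arguments hold addresses.
\<close>

fun event_of ::
    "('p, 'x, 'a, 'd) memory \<Rightarrow> 't \<Rightarrow> ('p, 'x, 'a, 'd, 'f, 'c) com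
       \<Rightarrow> ('f, 't, 'a, 'd) event list" where
  "event_of m t (Enter f ps xs) =
     [Func f t (map (\<lambda>p. adr_of (pmem m (PVar p))) ps) (map (\<lambda>x. dmem m (DVar x)) xs)]"
| "event_of m t Exit = [ExitEv t]"
| "event_of m t (FreeVar p) = [FreeEv (adr_of (pmem m (PVar p)))]"
| "event_of m t (FreeAdr a) = [FreeEv a]"
| "event_of m t _ = []"

primrec history ::
    "('p, 'x, 'a, 'd::zero, 'f, 'c, 't) computation \<Rightarrow> ('f, 't, 'a, 'd) event list" where
  "history [] = []"
| "history (act # \<tau>) = history \<tau> @ (case act of (t, com, up) \<Rightarrow> event_of (mem \<tau>) t com)"


section \<open>Observers\<close>

datatype ('t, 'a, 'd) val = ThreadVal 't | AdrVal 'a | DataVal 'd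

datatype 'f event_type = FuncT 'f | ExitT | FreeT

fun event_type_of :: "('f, 't, 'a, 'd) event \<Rightarrow> 'f event_type" where
  "event_type_of (Func f t as ds) = FuncT f"
| "event_type_of (ExitEv t) = ExitT"
| "event_type_of (FreeEv a) = FreeT"

fun event_args :: "('f, 't, 'a, 'd) event \<Rightarrow> ('t, 'a, 'd) val option list" where
  "event_args (Func f t as ds) =
     Some (ThreadVal t) # map (\<lambda>a. Some (AdrVal a)) as @ map (map_option DataVal) ds"
| "event_args (ExitEv t) = [Some (ThreadVal t)]"
| "event_args (FreeEv a) = [Some (AdrVal a)]"

text \<open>\<^typ>\<open>'z\<close> are the observer variables and \<^typ>\<open>'r\<close> the formal parameters.\<close>

datatype ('z, 'r) gterm = ObsVar 'z | Param 'r

datatype ('z, 'r) guard =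
    GTrue
  | GEq "('z, 'r) gterm" "('z, 'r) gterm"
  | GNot "('z, 'r) guard"
  | GAnd "('z, 'r) guard" "('z, 'r) guard"

fun eval_gterm :: "('z \<Rightarrow> 'v) \<Rightarrow> ('r \<Rightarrow> 'v option) \<Rightarrow> ('z, 'r) gterm \<Rightarrow> 'v option" where
  "eval_gterm \<phi> \<rho> (ObsVar z) = Some (\<phi> z)"
| "eval_gterm \<phi> \<rho> (Param r) = \<rho> r"

fun eval_guard :: "('z \<Rightarrow> 'v) \<Rightarrow> ('r \<Rightarrow> 'v option) \<Rightarrow> ('z, 'r) guard \<Rightarrow> bool" where
  "eval_guard \<phi> \<rho> GTrue \<longleftrightarrow> True"
| "eval_guard \<phi> \<rho> (GEq u v) \<longleftrightarrow> eval_gterm \<phi> \<rho> u = eval_gterm \<phi> \<rho> v"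
| "eval_guard \<phi> \<rho> (GNot g) \<longleftrightarrow> \<not> eval_guard \<phi> \<rho> g"
| "eval_guard \<phi> \<rho> (GAnd g h) \<longleftrightarrow> eval_guard \<phi> \<rho> g \<and> eval_guard \<phi> \<rho> h"

text \<open>A transition \<open>(l, f, rs, g, l')\<close> is labelled with the event type \<open>f\<close>, the formal
  parameters \<open>rs\<close> and the guard \<open>g\<close>.\<close>

record ('o, 'f, 'z, 'r) observer =
  oinit :: 'o
  oaccept :: "'o set"
  otrans :: "('o \<times> 'f event_type \<times> 'r list \<times> ('z, 'r) guard \<times> 'o) set"

type_synonym ('o, 'z, 't, 'a, 'd) ostate = "'o \<times> ('z \<Rightarrow> ('t, 'a, 'd) val)"

inductive obs_step ::
    "('o, 'f, 'z, 'r) observer \<Rightarrow> ('o, 'z, 't, 'a, 'd) ostate \<Rightarrow> ('f, 't, 'a, 'd) event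
       \<Rightarrow> ('o, 'z, 't, 'a, 'd) ostate \<Rightarrow> bool"
  for Obs where
  "\<lbrakk> (l, event_type_of ev, rs, g, l') \<in> otrans Obs;
     length rs = length (event_args ev);
     eval_guard \<phi> (\<lambda>r. Option.bind (map_of (zip rs (event_args ev)) r) id) g \<rbrakk>
   \<Longrightarrow> obs_step Obs (l, \<phi>) ev (l', \<phi>)"

inductive obs_run ::
    "('o, 'f, 'z, 'r) observer \<Rightarrow> ('o, 'z, 't, 'a, 'd) ostate \<Rightarrow> ('f, 't, 'a, 'd) event list
       \<Rightarrow> ('o, 'z, 't, 'a, 'd) ostate \<Rightarrow> bool"
  for Obs where
  "obs_run Obs s [] s"
| "obs_step Obs s ev s' \<Longrightarrow> obs_run Obs s' h s'' \<Longrightarrow> obs_run Obs s (ev # h) s''"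

definition state_spec ::
    "('o, 'f, 'z, 'r) observer \<Rightarrow> ('o, 'z, 't, 'a, 'd) ostate \<Rightarrow> ('f, 't, 'a, 'd) event list set" where
  "state_spec Obs s = {h. \<nexists>s'. obs_run Obs s h s' \<and> fst s' \<in> oaccept Obs}"

definition spec ::
    "('o, 'f, 'z, 'r) observer \<Rightarrow> ('f, 't, 'a, 'd) event list set" where
  "spec Obs = (\<Inter>\<phi> :: 'z \<Rightarrow> ('t, 'a, 'd) val. state_spec Obs (oinit Obs, \<phi>))"


section \<open>Programs\<close>

text \<open>
  A location and a command determine the next location; \<^const>\<open>None\<close> means that the command is
  not available at the location. \<open>pvars\<close> and \<open>dvars\<close> are the variables of the data structure;
  all other variables are variables of the SMR implementation.
\<close>

record ('p, 'x, 'a, 'd, 'f, 'c, 't, 'ld) program =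
  dinit :: "'t \<Rightarrow> 'ld"
  dstep :: "'ld \<Rightarrow> ('p, 'x, 'a, 'd, 'f, 'c) com \<rightharpoonup> 'ld"
  pvars :: "'p set"
  dvars :: "'x set"

definition client_com :: "('p, 'x, 'a, 'd, 'f, 'c) com \<Rightarrow> bool" where
  "client_com com \<longleftrightarrow> \<not> is_FreeVar com \<and> \<not> is_FreeAdr com \<and> \<not> is_RCom com"

text \<open>
  The second conjunct makes \<open>enter\<close> and \<open>exit\<close> match: there is a set of return locations,
  which are exactly the locations entered by an \<open>enter\<close>, and at which \<open>exit\<close> and nothing else
  can be executed.
\<close>

definition data_structure :: "('p, 'x, 'a, 'd, 'f, 'c, 't, 'ld) program \<Rightarrow> bool" where
  "data_structure D \<longleftrightarrow>
     (\<forall>l com l'. dstep D l com = Some l' \<longrightarrow>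
        client_com com \<and> pvars_com com \<subseteq> pvars D \<and> dvars_com com \<subseteq> dvars D) \<and>
     (\<exists>Ret. (\<forall>t. dinit D t \<notin> Ret) \<and>
        (\<forall>l com l'. dstep D l com = Some l' \<longrightarrow>
           (com = Exit \<longleftrightarrow> l \<in> Ret) \<and> (is_Enter com \<longleftrightarrow> l' \<in> Ret)))"

text \<open>
  For SMR implementations, \<^term>\<open>Some None\<close> as a result of \<open>rstep\<close> means that the function
  returns, and \<^const>\<open>None\<close> as a result of \<open>rentry\<close> that the called function is empty. \<open>rsem\<close>
  gives the possible updates of the unspecified commands.
\<close>

record ('p, 'x, 'a, 'd, 'f, 'c, 't, 'lr) smr =
  rentry :: "'f \<Rightarrow> 'p list \<Rightarrow> 'x list \<Rightarrow> 'lr option"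
  rstep :: "'lr \<Rightarrow> ('p, 'x, 'a, 'd, 'f, 'c) com \<rightharpoonup> 'lr option"
  rsem :: "'t \<Rightarrow> 'c \<Rightarrow> ('p, 'x, 'a, 'd) memory \<Rightarrow> ('p, 'x, 'a, 'd) update set"

definition smr_implementation :: "('p, 'x, 'a, 'd, 'f, 'c, 't, 'lr) smr \<Rightarrow> bool" where
  "smr_implementation R \<longleftrightarrow>
     (\<forall>l com. rstep R l com \<noteq> None \<longrightarrow> \<not> is_Enter com \<and> com \<noteq> Exit \<and> \<not> is_FreeAdr com)"

text \<open>
  The control of a thread is a pair \<open>(pc\<^sub>D, pc\<^sub>R)\<close>. While \<open>pc\<^sub>R\<close> is defined, \<open>pc\<^sub>D\<close> is the
  return location, that is, the location of the matching \<open>exit\<close>; that \<open>exit\<close> is executed once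
  \<open>pc\<^sub>R\<close> has become undefined.
\<close>

fun available ::
    "('p, 'x, 'a, 'd, 'f, 'c, 't, 'ld) program \<Rightarrow> ('p, 'x, 'a, 'd, 'f, 'c, 't, 'lr) smr
       \<Rightarrow> 'ld \<times> 'lr option \<Rightarrow> ('p, 'x, 'a, 'd, 'f, 'c) com \<Rightarrow> bool" where
  "available D R (l, None) com \<longleftrightarrow> dstep D l com \<noteq> None"
| "available D R (l, Some r) com \<longleftrightarrow> rstep R r com \<noteq> None"

text \<open>The next control is relevant only for available commands.\<close>

fun next_ctrl ::
    "('p, 'x, 'a, 'd, 'f, 'c, 't, 'ld) program \<Rightarrow> ('p, 'x, 'a, 'd, 'f, 'c, 't, 'lr) smr
       \<Rightarrow> 'ld \<times> 'lr option \<Rightarrow> ('p, 'x, 'a, 'd, 'f, 'c) com \<Rightarrow> 'ld \<times> 'lr option" where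
  "next_ctrl D R (l, None) com =
     (the (dstep D l com), (case com of Enter f ps xs \<Rightarrow> rentry R f ps xs | _ \<Rightarrow> None))"
| "next_ctrl D R (l, Some r) com = (l, the (rstep R r com))"

primrec ctrl ::
    "('p, 'x, 'a, 'd, 'f, 'c, 't, 'ld) program \<Rightarrow> ('p, 'x, 'a, 'd, 'f, 'c, 't, 'lr) smr
       \<Rightarrow> ('p, 'x, 'a, 'd, 'f, 'c, 't) computation \<Rightarrow> 't \<Rightarrow> 'ld \<times> 'lr option" where
  "ctrl D R [] = (\<lambda>t. (dinit D t, None))"
| "ctrl D R (act # \<tau>) =
     (case act of (t, com, up) \<Rightarrow>
        (ctrl D R \<tau>)(t := next_ctrl D R (ctrl D R \<tau> t) com))"

definition ctrl_D ::
    "('p, 'x, 'a, 'd, 'f, 'c, 't, 'ld) program \<Rightarrow> ('p, 'x, 'a, 'd, 'f, 'c, 't, 'lr) smr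
       \<Rightarrow> ('p, 'x, 'a, 'd, 'f, 'c, 't) computation \<Rightarrow> 't \<Rightarrow> 'ld" where
  "ctrl_D D R \<tau> = (\<lambda>t. fst (ctrl D R \<tau> t))"

definition ctrl_R ::
    "('p, 'x, 'a, 'd, 'f, 'c, 't, 'ld) program \<Rightarrow> ('p, 'x, 'a, 'd, 'f, 'c, 't, 'lr) smr
       \<Rightarrow> ('p, 'x, 'a, 'd, 'f, 'c, 't) computation \<Rightarrow> 't \<Rightarrow> 'lr option" where
  "ctrl_R D R \<tau> = (\<lambda>t. snd (ctrl D R \<tau> t))"


section \<open>Semantics\<close>

text \<open>
  (In)equality is on possibly undefined values, that is, undefined equals undefined;
  \<open><\<close> requires both values to be defined.
\<close>

fun holds :: "('p, 'x, 'a, 'd::ord) memory \<Rightarrow> ('p, 'x) cond \<Rightarrow> bool" where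
  "holds m (PEq p q) \<longleftrightarrow> pmem m (PVar p) = pmem m (PVar q)"
| "holds m (PNeq p q) \<longleftrightarrow> pmem m (PVar p) \<noteq> pmem m (PVar q)"
| "holds m (DEq x y) \<longleftrightarrow> dmem m (DVar x) = dmem m (DVar y)"
| "holds m (DNeq x y) \<longleftrightarrow> dmem m (DVar x) \<noteq> dmem m (DVar y)"
| "holds m (DLess x y) \<longleftrightarrow>
     (\<exists>d e. dmem m (DVar x) = Some d \<and> dmem m (DVar y) = Some e \<and> d < e)"

text \<open>
  The memory updates with which a command can be executed after \<open>\<tau>\<close>, control aside.
  The environment's frees and the unspecified commands have their own rules below. Loading a
  field of a freed address yields undefined, and \<open>op\<close> is strict in undefined arguments.
\<close>

fun enabled ::
    "'a set \<Rightarrow> ('p, 'x, 'a, 'd::{zero,ord}, 'f, 'c, 't) computation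
       \<Rightarrow> ('p, 'x, 'a, 'd, 'f, 'c) com \<Rightarrow> ('p, 'x, 'a, 'd) update \<Rightarrow> bool" where
  "enabled X \<tau> (PAssign p q) up \<longleftrightarrow> up = pset (PVar p) (pmem (mem \<tau>) (PVar q))"
| "enabled X \<tau> (PLoad p q) up \<longleftrightarrow>
     (\<exists>a. pmem (mem \<tau>) (PVar q) = Some (Adr a) \<and> up = pset (PVar p) (pmem (mem \<tau>) (Next a)))"
| "enabled X \<tau> (PStore p q) up \<longleftrightarrow>
     (\<exists>a. pmem (mem \<tau>) (PVar p) = Some (Adr a) \<and> up = pset (Next a) (pmem (mem \<tau>) (PVar q)))"
| "enabled X \<tau> (DAssign x op xs) up \<longleftrightarrow>
     up = dset (DVar x) (map_option op (those (map (\<lambda>y. dmem (mem \<tau>) (DVar y)) xs)))"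
| "enabled X \<tau> (DLoad x q) up \<longleftrightarrow>
     (\<exists>a. pmem (mem \<tau>) (PVar q) = Some (Adr a) \<and> up = dset (DVar x) (dmem (mem \<tau>) (Data a)))"
| "enabled X \<tau> (DStore p x) up \<longleftrightarrow>
     (\<exists>a. pmem (mem \<tau>) (PVar p) = Some (Adr a) \<and> up = dset (Data a) (dmem (mem \<tau>) (DVar x)))"
| "enabled X \<tau> (Assert b) up \<longleftrightarrow> holds (mem \<tau>) b \<and> up = no_update"
| "enabled X \<tau> (Malloc p) up \<longleftrightarrow>
     (\<exists>a d. a \<in> fresh \<tau> \<union> (freed \<tau> \<inter> X) \<and> up = malloc_update p a d)"
| "enabled X \<tau> (Enter f ps xs) up \<longleftrightarrow>
     (\<forall>p \<in> set ps. \<exists>a. pmem (mem \<tau>) (PVar p) = Some (Adr a)) \<and> up = no_update"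
| "enabled X \<tau> Exit up \<longleftrightarrow> up = no_update"
| "enabled X \<tau> (FreeVar p) up \<longleftrightarrow>
     (\<exists>a. pmem (mem \<tau>) (PVar p) = Some (Adr a) \<and> up = free_update a)"
| "enabled X \<tau> (FreeAdr a) up \<longleftrightarrow> False"
| "enabled X \<tau> (RCom c) up \<longleftrightarrow> False"

inductive_set sem ::
    "'a set \<Rightarrow> ('p, 'x, 'a, 'd::{zero,ord}, 'f, 'c, 't, 'ld) program
       \<Rightarrow> ('p, 'x, 'a, 'd, 'f, 'c, 't, 'lr) smr
       \<Rightarrow> ('p, 'x, 'a, 'd, 'f, 'c, 't) computation set"
  for X D R where
  empty: "[] \<in> sem X D R"
| step: "\<lbrakk> \<tau> \<in> sem X D R; available D R (ctrl D R \<tau> t) com; enabled X \<tau> com up \<rbrakk>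
    \<Longrightarrow> (t, com, up) # \<tau> \<in> sem X D R"
| rcom: "\<lbrakk> \<tau> \<in> sem X D R; available D R (ctrl D R \<tau> t) (RCom c); up \<in> rsem R t c (mem \<tau>) \<rbrakk>
    \<Longrightarrow> (t, RCom c, up) # \<tau> \<in> sem X D R"

text \<open>In \<open>D(O)\<close>, calls have no body: an \<open>enter\<close> leads directly to the location of its \<open>exit\<close>.\<close>

primrec ctrl_O ::
    "('p, 'x, 'a, 'd, 'f, 'c, 't, 'ld) program
       \<Rightarrow> ('p, 'x, 'a, 'd, 'f, 'c, 't) computation \<Rightarrow> 't \<Rightarrow> 'ld" where
  "ctrl_O D [] = dinit D"
| "ctrl_O D (act # \<sigma>) =
     (case act of (t, com, up) \<Rightarrow>
        if is_FreeAdr com then ctrl_O D \<sigma>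
        else (ctrl_O D \<sigma>)(t := the (dstep D (ctrl_O D \<sigma> t) com)))"

inductive_set sem_O ::
    "'a set \<Rightarrow> ('p, 'x, 'a, 'd::{zero,ord}, 'f, 'c, 't, 'ld) program
       \<Rightarrow> ('o, 'f, 'z, 'r) observer
       \<Rightarrow> ('p, 'x, 'a, 'd, 'f, 'c, 't) computation set"
  for X D Obs where
  empty: "[] \<in> sem_O X D Obs"
| step: "\<lbrakk> \<sigma> \<in> sem_O X D Obs; dstep D (ctrl_O D \<sigma> t) com \<noteq> None; enabled X \<sigma> com up \<rbrakk>
    \<Longrightarrow> (t, com, up) # \<sigma> \<in> sem_O X D Obs"
| free: "\<lbrakk> \<sigma> \<in> sem_O X D Obs; history \<sigma> @ [FreeEv a] \<in> spec Obs \<rbrakk>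
    \<Longrightarrow> (t, FreeAdr a, free_update a) # \<sigma> \<in> sem_O X D Obs"


section \<open>The most general client\<close>

text \<open>
  Every thread may at any time call any function with any arguments, and between calls run
  arbitrary client commands over the given variables to prepare these arguments and the
  memory they refer to. The location \<^const>\<open>True\<close> is that of the \<open>exit\<close> matching a call.
\<close>

definition mgc :: "'p set \<Rightarrow> 'x set \<Rightarrow> ('p, 'x, 'a, 'd, 'f, 'c, 't, bool) program" where
  "mgc P V =
     \<lparr> dinit = (\<lambda>t. False),
       dstep = (\<lambda>l com.
         if client_com com \<and> pvars_com com \<subseteq> P \<and> dvars_com com \<subseteq> V \<and> (com = Exit \<longleftrightarrow> l)
         then Some (is_Enter com) else None),
       pvars = P, dvars = V \<rparr>"

definition satisfies_spec ::
    "'p set \<Rightarrow> 'x set \<Rightarrow> ('p, 'x, 'a, 'd::{zero,ord}, 'f, 'c, 't, 'lr) smr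
       \<Rightarrow> ('o, 'f, 'z, 'r) observer \<Rightarrow> bool" where
  "satisfies_spec P V R Obs \<longleftrightarrow> (\<forall>\<tau> \<in> sem UNIV (mgc P V) R. history \<tau> \<in> spec Obs)"


section \<open>Compositionality and correctness\<close>

primrec mem_D ::
    "('p, 'x, 'a, 'd::zero, 'f, 'c, 't, 'ld) program \<Rightarrow> ('p, 'x, 'a, 'd, 'f, 'c, 't, 'lr) smr
       \<Rightarrow> ('p, 'x, 'a, 'd, 'f, 'c, 't) computation \<Rightarrow> ('p, 'x, 'a, 'd) memory" where
  "mem_D D R [] = init_mem (pvars D) (dvars D)"
| "mem_D D R (act # \<tau>) =
     (case act of (t, com, up) \<Rightarrow>
        if is_FreeVar com \<or> ctrl_R D R \<tau> t = None
        then apply_update (mem_D D R \<tau>) up else mem_D D R \<tau>)"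

primrec mem_R ::
    "('p, 'x, 'a, 'd::zero, 'f, 'c, 't, 'ld) program \<Rightarrow> ('p, 'x, 'a, 'd, 'f, 'c, 't, 'lr) smr
       \<Rightarrow> ('p, 'x, 'a, 'd, 'f, 'c, 't) computation \<Rightarrow> ('p, 'x, 'a, 'd) memory" where
  "mem_R D R [] = init_mem (- pvars D) (- dvars D)"
| "mem_R D R (act # \<tau>) =
     (case act of (t, com, up) \<Rightarrow>
        if is_FreeVar com \<or> ctrl_R D R \<tau> t \<noteq> None
        then apply_update (mem_R D R \<tau>) up else mem_R D R \<tau>)"

definition disjoint_union ::
    "('p, 'x, 'a, 'd) memory \<Rightarrow> ('p, 'x, 'a, 'd) memory \<Rightarrow> ('p, 'x, 'a, 'd) memory \<Rightarrow> bool" where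
  "disjoint_union m m1 m2 \<longleftrightarrow>
     dom (pmem m1) \<inter> dom (pmem m2) = {} \<and> pmem m = pmem m1 ++ pmem m2 \<and>
     dom (dmem m1) \<inter> dom (dmem m2) = {} \<and> dmem m = dmem m1 ++ dmem m2"

definition compositional_computation ::
    "('p, 'x, 'a, 'd::zero, 'f, 'c, 't, 'ld) program \<Rightarrow> ('p, 'x, 'a, 'd, 'f, 'c, 't, 'lr) smr
       \<Rightarrow> ('p, 'x, 'a, 'd, 'f, 'c, 't) computation \<Rightarrow> bool" where
  "compositional_computation D R \<tau> \<longleftrightarrow>
     (\<forall>\<rho> t com up \<sigma>. \<tau> = \<rho> @ (t, com, up) # \<sigma> \<longrightarrow>
        (let m = mem ((t, com, up) # \<sigma>);
             mD = mem_D D R ((t, com, up) # \<sigma>);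
             mR = mem_R D R ((t, com, up) # \<sigma>)
         in disjoint_union m mD mR \<and>
            (\<forall>p \<in> pvars D. pmem m (PVar p) = pmem mD (PVar p)) \<and>
            (\<forall>x \<in> dvars D. dmem m (DVar x) = dmem mD (DVar x))) \<and>
        (ctrl_R D R \<sigma> t = None \<longrightarrow>
           (\<forall>p q a. com = PLoad q p \<and> pmem (mem \<sigma>) (PVar p) = Some (Adr a) \<longrightarrow>
              pmem (mem \<sigma>) (Next a) = pmem (mem_D D R \<sigma>) (Next a)) \<and>
           (\<forall>p x a. com = DLoad x p \<and> pmem (mem \<sigma>) (PVar p) = Some (Adr a) \<longrightarrow>
              dmem (mem \<sigma>) (Data a) = dmem (mem_D D R \<sigma>) (Data a))))"

definition compositional ::
    "('p, 'x, 'a, 'd::{zero,ord}, 'f, 'c, 't, 'ld) program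
       \<Rightarrow> ('p, 'x, 'a, 'd, 'f, 'c, 't, 'lr) smr \<Rightarrow> bool" where
  "compositional D R \<longleftrightarrow> (\<forall>\<tau> \<in> sem UNIV D R. compositional_computation D R \<tau>)"

definition correct ::
    "('t \<Rightarrow> 'ld) set \<Rightarrow> ('p, 'x, 'a, 'd::{zero,ord}, 'f, 'c, 't, 'ld) program
       \<Rightarrow> ('p, 'x, 'a, 'd, 'f, 'c, 't, 'lr) smr \<Rightarrow> bool" where
  "correct Bad D R \<longleftrightarrow> (\<nexists>\<tau>. \<tau> \<in> sem UNIV D R \<and> ctrl_D D R \<tau> \<in> Bad)"

definition correct_O ::
    "('t \<Rightarrow> 'ld) set \<Rightarrow> ('p, 'x, 'a, 'd::{zero,ord}, 'f, 'c, 't, 'ld) program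
       \<Rightarrow> ('o, 'f, 'z, 'r) observer \<Rightarrow> bool" where
  "correct_O Bad D Obs \<longleftrightarrow>
     (\<nexists>\<sigma> :: ('p, 'x, 'a, 'd, 'f, 'c, 't) computation. \<sigma> \<in> sem_O UNIV D Obs \<and> ctrl_O D \<sigma> \<in> Bad)"

end

theory Submission
  imports Defs
begin

text \<open>
  A computation \<open>\<tau>\<close> of \<open>D(R)\<close> is simulated by the computation of \<open>D(O)\<close> that keeps the actions
  of \<open>D\<close>, turns every \<open>free(p)\<close> into the environment's \<open>free(a)\<close> and drops all other actions
  of \<open>R\<close>. The memory of the simulating computation is \<open>m\<^sup>D\<close> up to the variables of \<open>R\<close>, so
  compositionality makes the actions of \<open>D\<close> enabled with unchanged updates; allocations of \<open>R\<close>
  are dropped, so at least as many addresses remain allocatable. Both computations induce the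
  same history. As \<open>\<tau>\<close> is also a computation of the most general client, this history satisfies
  the specification, which permits the environment's frees.
\<close>

section \<open>The most general client\<close>

text \<open>The very same action list is run by the most general client: sending a location
  \<open>l\<close> of \<open>D\<close> to the Boolean \<open>l \<in> Ret\<close> and keeping the
  location in \<open>R\<close> preserves available commands and next controls. Memories and updates
  depend on the list alone.\<close>

lemma sem_subset_sem_mgc:
  assumes D: "data_structure D"
  shows "sem X D R \<subseteq> sem X (mgc (pvars D) (dvars D)) R"
proof
  fix \<tau> assume "\<tau> \<in> sem X D R"
  let ?M = "mgc (pvars D) (dvars D)"
  obtain Ret where init: "\<And>t. dinit D t \<notin> Ret"
    and ret: "\<And>l com l'. dstep D l com = Some l' \<Longrightarrow>
      (com = Exit \<longleftrightarrow> l \<in> Ret) \<and> (is_Enter com \<longleftrightarrow> l' \<in> Ret)"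
    using D unfolding data_structure_def by metis
  have client: "client_com com \<and> pvars_com com \<subseteq> pvars D \<and> dvars_com com \<subseteq> dvars D"
    if "dstep D l com = Some l'" for l com l'
    using D that unfolding data_structure_def by blast
  have avail: "available ?M R (l \<in> Ret, r) com
      \<and> next_ctrl ?M R (l \<in> Ret, r) com
          = (fst (next_ctrl D R (l, r) com) \<in> Ret, snd (next_ctrl D R (l, r) com))"
    if "available D R (l, r) com" for l r com
  proof (cases r)
    case None
    with that obtain l' where l': "dstep D l com = Some l'"
      by auto
    with None ret[OF l'] client[OF l'] show ?thesis
      by (simp add: mgc_def)
  qed (use that in simp)
  from \<open>\<tau> \<in> sem X D R\<close> have "\<tau> \<in> sem X ?M R \<and>
      ctrl ?M R \<tau> = (\<lambda>t. (fst (ctrl D R \<tau> t) \<in> Ret, snd (ctrl D R \<tau> t)))"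
  proof induction
    case empty
    show ?case
      by (simp add: sem.empty mgc_def init)
  next
    case (step \<tau> t com up)
    then show ?case
      using avail[of "fst (ctrl D R \<tau> t)" "snd (ctrl D R \<tau> t)" com]
      by (auto simp: fun_eq_iff intro: sem.step)
  next
    case (rcom \<tau> t c up)
    then show ?case
      using avail[of "fst (ctrl D R \<tau> t)" "snd (ctrl D R \<tau> t)" "RCom c"]
      by (auto simp: fun_eq_iff intro: sem.rcom)
  qed
  then show "\<tau> \<in> sem X ?M R" ..
qed

lemma history_in_spec:
  fixes D :: "('p, 'x, 'a, 'd::{zero,ord}, 'f, 'c, 't, 'ld) program"
  assumes "data_structure D" "satisfies_spec (pvars D) (dvars D) R Obs" "\<tau> \<in> sem UNIV D R"
  shows "history \<tau> \<in> spec Obs"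
  using assms sem_subset_sem_mgc unfolding satisfies_spec_def by blast


section \<open>Agreement of memories\<close>

text \<open>Variables and fields are kept apart because \<open>mem_D\<close> starts with the
  variables of \<open>R\<close> undefined, whereas \<open>mem\<close> initialises all of them: only
  the variables in \<open>P\<close> and \<open>V\<close> can be compared, but the fields of every
  address can.\<close>

definition agree_vars ::
    "'p set \<Rightarrow> 'x set \<Rightarrow> ('p, 'x, 'a, 'd) memory \<Rightarrow> ('p, 'x, 'a, 'd) memory \<Rightarrow> bool" where
  "agree_vars P V m m' \<longleftrightarrow>
     (\<forall>p \<in> P. pmem m (PVar p) = pmem m' (PVar p)) \<and>
     (\<forall>x \<in> V. dmem m (DVar x) = dmem m' (DVar x))"

definition agree_fields ::
    "('p, 'x, 'a, 'd) memory \<Rightarrow> ('p, 'x, 'a, 'd) memory \<Rightarrow> bool" where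
  "agree_fields m m' \<longleftrightarrow>
     (\<forall>a. pmem m (Next a) = pmem m' (Next a) \<and> dmem m (Data a) = dmem m' (Data a))"

lemma agree_vars_trans:
  "agree_vars P V m m' \<Longrightarrow> agree_vars P V m' m'' \<Longrightarrow> agree_vars P V m m''"
  by (simp add: agree_vars_def)

lemma agree_vars_mono:
  "agree_vars P V m m' \<Longrightarrow> P' \<subseteq> P \<Longrightarrow> V' \<subseteq> V \<Longrightarrow> agree_vars P' V' m m'"
  by (auto simp: agree_vars_def)

lemma agree_vars_apply_update:
  "agree_vars P V m m' \<Longrightarrow> agree_vars P V (apply_update m up) (apply_update m' up)"
  by (simp add: agree_vars_def apply_update_def override_def split: option.split)

lemma agree_fields_apply_update:
  "agree_fields m m' \<Longrightarrow> agree_fields (apply_update m up) (apply_update m' up)"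
  by (simp add: agree_fields_def apply_update_def override_def split: option.split)

lemma event_of_cong:
  "agree_vars (pvars_com com) (dvars_com com) m m' \<Longrightarrow> event_of m t com = event_of m' t com"
  by (cases com) (simp_all add: agree_vars_def)

lemma holds_cong:
  "agree_vars (pvars_cond b) (dvars_cond b) m m' \<Longrightarrow> holds m b \<longleftrightarrow> holds m' b"
  by (cases b) (simp_all add: agree_vars_def)

text \<open>Fields are required to agree only where a load reads them, since the memory of
  \<open>D(R)\<close> may contain further fields owned by \<open>R\<close>. For
  \<open>Malloc\<close> inclusions suffice, its condition being monotone in \<open>fresh\<close> and
  \<open>freed\<close>.\<close>

lemma enabled_transfer:
  assumes "enabled X \<tau> com up"
    and vars: "agree_vars (pvars_com com) (dvars_com com) (mem \<tau>) (mem \<sigma>)"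
    and pload: "\<And>p q a. com = PLoad q p \<Longrightarrow> pmem (mem \<tau>) (PVar p) = Some (Adr a) \<Longrightarrow>
      pmem (mem \<tau>) (Next a) = pmem (mem \<sigma>) (Next a)"
    and dload: "\<And>p x a. com = DLoad x p \<Longrightarrow> pmem (mem \<tau>) (PVar p) = Some (Adr a) \<Longrightarrow>
      dmem (mem \<tau>) (Data a) = dmem (mem \<sigma>) (Data a)"
    and alloc: "fresh \<tau> \<subseteq> fresh \<sigma>" "freed \<tau> \<subseteq> freed \<sigma>"
  shows "enabled X \<sigma> com up"
proof (cases com)
  case (DAssign x op xs)
  \<comment> \<open>The operation reads its argument list through \<open>those\<close>, so the two
    lists are equated as a whole and the equation must not be split pointwise.\<close>
  with vars have "map (\<lambda>y. dmem (mem \<tau>) (DVar y)) xs = map (\<lambda>y. dmem (mem \<sigma>) (DVar y)) xs"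
    by (simp add: agree_vars_def)
  with DAssign assms(1) show ?thesis
    by (simp del: map_eq_conv)
next
  case (Assert b)
  with vars assms(1) holds_cong[of b "mem \<tau>" "mem \<sigma>"] show ?thesis
    by simp
qed (use assms in \<open>auto simp: agree_vars_def\<close>)


section \<open>Simulation\<close>

text \<open>Stated with \<open>mem_D\<close> instead of \<open>mem\<close> so that it survives the
  writes of \<open>R\<close>, which leave \<open>mem_D\<close> alone. The passage from
  \<open>mem\<close> to \<open>mem_D\<close> is drawn from compositionality anew at each action of
  \<open>D\<close>.\<close>

definition simulates ::
    "('p, 'x, 'a, 'd::zero, 'f, 'c, 't, 'ld) program \<Rightarrow> ('p, 'x, 'a, 'd, 'f, 'c, 't, 'lr) smr
       \<Rightarrow> ('p, 'x, 'a, 'd, 'f, 'c, 't) computation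
       \<Rightarrow> ('p, 'x, 'a, 'd, 'f, 'c, 't) computation \<Rightarrow> bool" where
  "simulates D R \<tau> \<sigma> \<longleftrightarrow>
     ctrl_O D \<sigma> = ctrl_D D R \<tau> \<and>
     agree_vars (pvars D) (dvars D) (mem_D D R \<tau>) (mem \<sigma>) \<and>
     agree_fields (mem_D D R \<tau>) (mem \<sigma>) \<and>
     history \<sigma> = history \<tau> \<and> fresh \<tau> \<subseteq> fresh \<sigma> \<and> freed \<tau> \<subseteq> freed \<sigma>"

lemma simulates_Nil: "simulates D R [] []"
  by (simp add: simulates_def ctrl_D_def agree_vars_def agree_fields_def init_mem_def)

lemma compositional_agree_vars:
  assumes "compositional_computation D R \<tau>"
  shows "agree_vars (pvars D) (dvars D) (mem \<tau>) (mem_D D R \<tau>)"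
proof (cases \<tau>)
  \<comment> \<open>Compositionality speaks of nonempty prefixes only, so the initial memories are
    compared directly.\<close>
  case Nil
  then show ?thesis
    by (simp add: agree_vars_def init_mem_def)
next
  case (Cons act \<sigma>)
  obtain t com up where "act = (t, com, up)"
    by (cases act)
  with Cons have "\<tau> = [] @ (t, com, up) # \<sigma>"
    by simp
  with assms Cons \<open>act = _\<close> show ?thesis
    unfolding compositional_computation_def Let_def agree_vars_def by blast
qed

lemma compositional_load:
  assumes "compositional_computation D R ((t, com, up) # \<tau>)" "ctrl_R D R \<tau> t = None"
  shows "com = PLoad q p \<Longrightarrow> pmem (mem \<tau>) (PVar p) = Some (Adr a) \<Longrightarrow>
           pmem (mem \<tau>) (Next a) = pmem (mem_D D R \<tau>) (Next a)"
    and "com = DLoad x p \<Longrightarrow> pmem (mem \<tau>) (PVar p) = Some (Adr a) \<Longrightarrow>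
           dmem (mem \<tau>) (Data a) = dmem (mem_D D R \<tau>) (Data a)"
  using assms unfolding compositional_computation_def by blast+

text \<open>Compositionality is assumed for the extended computation because its condition on loads
  concerns the memory just before the last action.\<close>

lemma simulates_client_action:
  assumes D: "data_structure D"
    and sim: "simulates D R \<tau> \<sigma>"
    and vars: "agree_vars (pvars D) (dvars D) (mem \<tau>) (mem_D D R \<tau>)"
    and comp: "compositional_computation D R ((t, com, up) # \<tau>)"
    and ctrl: "ctrl D R \<tau> t = (l, None)" and dstep: "dstep D l com = Some l'"
    and en: "enabled X \<tau> com up"
  shows "dstep D (ctrl_O D \<sigma> t) com \<noteq> None" "enabled X \<sigma> com up"
    "simulates D R ((t, com, up) # \<tau>) ((t, com, up) # \<sigma>)"
proof -
  have client: "client_com com" "pvars_com com \<subseteq> pvars D" "dvars_com com \<subseteq> dvars D"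
    using D dstep unfolding data_structure_def by blast+
  note simD = sim[unfolded simulates_def]
  have agree: "agree_vars (pvars_com com) (dvars_com com) (mem \<tau>) (mem \<sigma>)"
    using agree_vars_mono[OF agree_vars_trans[OF vars]] client simD by blast
  have l: "ctrl_O D \<sigma> t = l"
    using simD ctrl by (simp add: ctrl_D_def)
  with dstep show "dstep D (ctrl_O D \<sigma> t) com \<noteq> None"
    by simp
  have pcR: "ctrl_R D R \<tau> t = None"
    by (simp add: ctrl_R_def ctrl)
  show "enabled X \<sigma> com up"
    using en agree
  proof (rule enabled_transfer)
    fix p q a assume "com = PLoad q p" "pmem (mem \<tau>) (PVar p) = Some (Adr a)"
    then show "pmem (mem \<tau>) (Next a) = pmem (mem \<sigma>) (Next a)"
      using compositional_load(1)[OF comp pcR] simD by (simp add: agree_fields_def)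
  next
    fix p x a assume "com = DLoad x p" "pmem (mem \<tau>) (PVar p) = Some (Adr a)"
    then show "dmem (mem \<tau>) (Data a) = dmem (mem \<sigma>) (Data a)"
      using compositional_load(2)[OF comp pcR] simD by (simp add: agree_fields_def)
  qed (use simD in auto)
  have "ctrl_O D ((t, com, up) # \<sigma>) = ctrl_D D R ((t, com, up) # \<tau>)"
    using simD client l ctrl by (auto simp: client_com_def ctrl_D_def fun_eq_iff)
  \<comment> \<open>Without deallocations, \<open>fresh\<close> and \<open>freed\<close> lose on
    both sides just the addresses allocated by the action, whatever the memory.\<close>
  moreover have "deallocated m (t, com, up) = {}" for m
    using client by (auto simp: client_com_def deallocated_def)
  ultimately show "simulates D R ((t, com, up) # \<tau>) ((t, com, up) # \<sigma>)"
    using simD event_of_cong[OF agree, symmetric] pcR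
    by (auto simp: simulates_def allocated_def simp del: ctrl_O.simps intro: agree_vars_apply_update agree_fields_apply_update)
qed

text \<open>A free is the one action of \<open>R\<close> that also updates \<open>mem_D\<close>, and
  its counterpart applies the same update. Neither moves the location in \<open>D\<close>, and both
  deallocate exactly \<open>a\<close>.\<close>

lemma simulates_free:
  assumes sim: "simulates D R \<tau> \<sigma>"
    and ctrl: "ctrl D R \<tau> t = (l, Some r)" and p: "pmem (mem \<tau>) (PVar p) = Some (Adr a)"
  shows "simulates D R ((t, FreeVar p, free_update a) # \<tau>) ((t, FreeAdr a, free_update a) # \<sigma>)"
proof -
  have "ctrl_O D ((t, FreeAdr a, free_update a) # \<sigma>) = ctrl_D D R ((t, FreeVar p, free_update a) # \<tau>)"
    using sim ctrl by (auto simp: simulates_def ctrl_D_def fun_eq_iff)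
  with sim p show ?thesis
    by (auto simp: simulates_def allocated_def deallocated_def adr_of_def
        intro: agree_vars_apply_update agree_fields_apply_update)
qed

text \<open>Such an action emits no event and leaves \<open>mem_D\<close> and the location in
  \<open>D\<close> unchanged; an allocation can only shrink \<open>fresh\<close> and
  \<open>freed\<close> on the side of \<open>\<tau>\<close>, which the inclusions allow.\<close>

lemma simulates_smr_action:
  assumes sim: "simulates D R \<tau> \<sigma>"
    and ctrl: "ctrl D R \<tau> t = (l, Some r)"
    and com: "\<not> is_Enter com" "com \<noteq> Exit" "\<not> is_FreeVar com" "\<not> is_FreeAdr com"
  shows "simulates D R ((t, com, up) # \<tau>) \<sigma>"
proof -
  have "ctrl_D D R ((t, com, up) # \<tau>) = ctrl_D D R \<tau>"
    using ctrl by (auto simp: ctrl_D_def fun_eq_iff)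
  moreover have "event_of (mem \<tau>) t com = []"
    using com by (cases com) auto
  moreover have "deallocated (mem \<tau>) (t, com, up) = {}"
    using com by (auto simp: deallocated_def)
  ultimately show ?thesis
    using sim ctrl com by (auto simp: simulates_def ctrl_R_def)
qed

theorem simulation:
  assumes D: "data_structure D" and R: "smr_implementation R" and comp: "compositional D R"
    and spec: "satisfies_spec (pvars D) (dvars D) R Obs"
    and "\<tau> \<in> sem UNIV D R"
  shows "\<exists>\<sigma> \<in> sem_O UNIV D Obs. simulates D R \<tau> \<sigma>"
  using \<open>\<tau> \<in> sem UNIV D R\<close>
proof induction
  case empty
  show ?case
    using sem_O.empty simulates_Nil by blast
next
  case (step \<tau> t com up)
  then obtain \<sigma> where \<sigma>: "\<sigma> \<in> sem_O UNIV D Obs" "simulates D R \<tau> \<sigma>"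
    by blast
  have \<tau>': "(t, com, up) # \<tau> \<in> sem UNIV D R"
    using step.hyps by (rule sem.step)
  obtain l pc where ctrl: "ctrl D R \<tau> t = (l, pc)"
    by fastforce
  show ?case
  proof (cases pc)
    case None
    with step.hyps ctrl obtain l' where l': "dstep D l com = Some l'"
      by auto
    \<comment> \<open>The condition on loads needs the extended computation, the agreement of
      variables before the action needs \<open>\<tau>\<close> itself.\<close>
    have "compositional_computation D R ((t, com, up) # \<tau>)"
      and "agree_vars (pvars D) (dvars D) (mem \<tau>) (mem_D D R \<tau>)"
      using comp \<tau>' step.hyps compositional_agree_vars unfolding compositional_def by blast+
    from simulates_client_action[OF D \<sigma>(2) this(2,1) ctrl[unfolded None] l' step.hyps(3)]
    show ?thesis
      using sem_O.step[OF \<sigma>(1)] by blast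
  next
    case (Some r)
    with step.hyps ctrl have "rstep R r com \<noteq> None"
      by simp
    with R have com: "\<not> is_Enter com" "com \<noteq> Exit" "\<not> is_FreeAdr com"
      unfolding smr_implementation_def by blast+
    show ?thesis
    proof (cases "is_FreeVar com")
      case True
      then obtain p where p: "com = FreeVar p"
        by (cases com) auto
      with step.hyps(3) obtain a
        where a: "pmem (mem \<tau>) (PVar p) = Some (Adr a)" "up = free_update a"
        by auto
      \<comment> \<open>The history that the environment's free must keep within the specification
        is the one induced by \<open>D(R)\<close> after \<open>free(p)\<close>.\<close>
      have "history ((t, com, up) # \<tau>) = history \<sigma> @ [FreeEv a]"
        using \<sigma>(2) p a by (simp add: simulates_def adr_of_def)
      then have "history \<sigma> @ [FreeEv a] \<in> spec Obs"
        using history_in_spec[OF D spec \<tau>'] by simp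
      then show ?thesis
        using sem_O.free[OF \<sigma>(1)] simulates_free[OF \<sigma>(2) ctrl[unfolded Some] a(1)] p a(2) by blast
    next
      case False
      then show ?thesis
        using simulates_smr_action[OF \<sigma>(2) ctrl[unfolded Some] com(1,2) _ com(3)] \<sigma>(1) by blast
    qed
  qed
next
  case (rcom \<tau> t c up)
  then obtain \<sigma> where \<sigma>: "\<sigma> \<in> sem_O UNIV D Obs" "simulates D R \<tau> \<sigma>"
    by blast
  obtain l pc where ctrl: "ctrl D R \<tau> t = (l, pc)"
    by fastforce
  \<comment> \<open>No client offers an unspecified command, so the thread must be inside
    \<open>R\<close>.\<close>
  have "dstep D l (RCom c) = None"
    using D unfolding data_structure_def client_com_def by fastforce
  with rcom.hyps(2) ctrl obtain r where "pc = Some r"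
    by (cases pc) auto
  with ctrl show ?case
    using simulates_smr_action[OF \<sigma>(2), of t l r "RCom c"] \<sigma>(1) by auto
qed

theorem theorem4p2:
  fixes D :: "('p, 'x, 'a, 'd::{zero,ord}, 'f, 'c, 't, 'ld) program"
    and R :: "('p, 'x, 'a, 'd, 'f, 'c, 't, 'lr) smr"
    and Obs :: "('o, 'f, 'z, 'r) observer"
    and Bad :: "('t \<Rightarrow> 'ld) set"
  assumes "data_structure D"
    and "smr_implementation R"
    and "compositional D R"
    and "satisfies_spec (pvars D) (dvars D) R Obs"
    and "correct_O Bad D Obs"
  shows "correct Bad D R"
  unfolding correct_def
proof
  assume "\<exists>\<tau>. \<tau> \<in> sem UNIV D R \<and> ctrl_D D R \<tau> \<in> Bad"
  then obtain \<tau> where \<tau>: "\<tau> \<in> sem UNIV D R" "ctrl_D D R \<tau> \<in> Bad"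
    by blast
  obtain \<sigma> where "\<sigma> \<in> sem_O UNIV D Obs" "simulates D R \<tau> \<sigma>"
    using simulation[OF assms(1-4) \<tau>(1)] by blast
  with \<tau>(2) assms(5) show False
    unfolding correct_O_def simulates_def by metis
qed

end
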